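(* For every integer $r\ge1$ and every $n\ge1$, as an identity of polynomials in $t$, $$\ddot H_n\Bigl(\frac{1}{(\cos x-t\sin x)^{r}}\Bigr) =\bigl(t(t^2+1)\bigr)^{\binom n2}\, \ddot H_n\Bigl(\frac{1}{(1-x)^{r}}\Bigr).$$
   Context: For a formal power series $f(x)=\sum_{k\ge0}a_kx^k/k!$ in $x$, the dilated Hankel determinant is $\ddot H_n(f)=\det(a_{2i+j})_{0\le i,j\le n-1}$. Here $t$ is a parameter (indeterminate) on which the coefficients $a_k$ depend polynomially. *)

theory Defs
  imports
    "HOL-Computational_Algebra.Formal_Power_Series"
    "HOL-Computational_Algebra.Polynomial"
    "Jordan_Normal_Form.Determinant"
begin

definition egf_coeff :: "'a::comm_ring_1 fps \<Rightarrow> nat \<Rightarrow> 'a" where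
  "egf_coeff f k = of_nat (fact k) * fps_nth f k"

definition dilated_hankel :: "nat \<Rightarrow> 'a::comm_ring_1 fps \<Rightarrow> 'a" where
  "dilated_hankel n f = det (mat n n (\<lambda>(i, j). egf_coeff f (2 * i + j)))"

(* The base ring of the series is the polynomial ring K[t], which is not a field, so neither
   the library's fps_cos and fps_sin nor inverse apply to it directly: cos and sin are taken over
   K and embedded coefficientwise, and the reciprocal is the library's inverse of a power series
   over a ring, determined by the inverse of the constant term. *)

definition fps_constant_poly :: "'a::zero fps \<Rightarrow> 'a poly fps" where
  "fps_constant_poly f = Abs_fps (\<lambda>k. [:fps_nth f k:])"

(* A reciprocal only for series with constant term 1. *)
definition fps_recip1 :: "'a::comm_ring_1 fps \<Rightarrow> 'a fps" where
  "fps_recip1 f = fps_right_inverse f 1"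

lemma fps_recip1_unique:
  assumes "fps_nth f 0 = 1"
  shows "f * g = 1 \<longleftrightarrow> g = fps_recip1 f"
proof
  have inv: "f * fps_recip1 f = 1"
    using assms unfolding fps_recip1_def by (simp add: fps_right_inverse)
  then show "g = fps_recip1 f \<Longrightarrow> f * g = 1" by simp
  show "g = fps_recip1 f" if "f * g = 1"
    by (metis inv that mult.assoc mult.commute mult_1)
qed

definition cos_minus_t_sin :: "'a::field_char_0 poly fps" where
  "cos_minus_t_sin =
     fps_constant_poly (fps_cos 1) - fps_const [:0, 1:] * fps_constant_poly (fps_sin 1)"

lemma fps_nth_cos_minus_t_sin_0: "fps_nth cos_minus_t_sin 0 = 1"
  by (simp add: cos_minus_t_sin_def fps_constant_poly_def)

end

theory Submission imports Defs begin

text \<open>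
  Write \<open>s = 1 + t\<^sup>2\<close>. Both \<open>\<partial>/\<partial>x - s \<partial>/\<partial>t\<close> on the left and
  \<open>(1 - x) d/dx\<close> on the right are derivations that multiply the base of the power by a factor
  free of \<open>x\<close>, namely \<open>- t\<close> and \<open>- 1\<close>.
  Hence the coefficients on the left are \<open>L\<^sub>r\<^sup>k 1\<close>, where \<open>L\<^sub>r = s d/dt + r t\<close>, and
  those on the right are the rising factorials of \<open>r\<close>. (Under \<open>t = tan u\<close>, \<open>L\<^sub>r\<close> is
  \<open>d/du\<close> acting on multiples of \<open>sec\<^sup>r u\<close>.)

  Since \<open>L\<^sub>r\<^sup>2 s\<^sup>m\<close> is a combination of \<open>s\<^sup>m\<^sup>+\<^sup>1\<close> and \<open>s\<^sup>m\<close>, row operations turn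
  row \<open>i\<close> on the left into \<open>L\<^sub>r\<^sup>j s\<^sup>i = s\<^sup>i L\<^sub>r\<^sub>+\<^sub>2\<^sub>i\<^sup>j 1\<close> times the rising factorial
  of \<open>r\<close> of length \<open>2 i\<close>. As \<open>L\<^sub>q\<^sup>j 1\<close> is a polynomial in \<open>q\<close> of degree \<open>j\<close> with
  leading coefficient \<open>t\<^sup>j\<close>, column operations leave the Vandermonde matrix of the points
  \<open>r + 2 i\<close>. The right-hand side reduces to the same Vandermonde matrix.
\<close>

section \<open>Reduction to a Vandermonde determinant\<close>

text \<open>The matrix factors as \<open>C * (V * U)\<close>: \<open>C\<close> holds the row
  combinations, \<open>V\<close> is the Vandermonde matrix of the points \<open>x m\<close>, and
  \<open>U\<close> holds the coefficients of the \<open>p j\<close>, upper triangular by the degree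
  bound.\<close>

lemma det_triangular_poly_triangular:
  fixes c :: "nat \<Rightarrow> nat \<Rightarrow> 'a::idom" and p :: "nat \<Rightarrow> 'a poly" and x :: "nat \<Rightarrow> 'a"
  assumes deg: "\<And>j. degree (p j) \<le> j"
  shows "det (mat n n (\<lambda>(i, j). \<Sum>m\<le>i. c i m * poly (p j) (x m))) =
    (\<Prod>i<n. c i i) * (\<Prod>j<n. coeff (p j) j) * det (mat n n (\<lambda>(i, j). x i ^ j))"
proof -
  define C where "C = mat n n (\<lambda>(i, m). if m \<le> i then c i m else 0)"
  define V where "V = mat n n (\<lambda>(i, j). x i ^ j)"
  define U where "U = mat n n (\<lambda>(k, j). coeff (p j) k)"
  have carr: "C \<in> carrier_mat n n" "V \<in> carrier_mat n n" "U \<in> carrier_mat n n"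
    by (auto simp: C_def V_def U_def)
  have VU: "V * U = mat n n (\<lambda>(m, j). poly (p j) (x m))"
  proof (rule eq_matI)
    fix m j assume "m < dim_row (mat n n (\<lambda>(m, j). poly (p j) (x m)))"
      and "j < dim_col (mat n n (\<lambda>(m, j). poly (p j) (x m)))"
    then have mj: "m < n" "j < n" by auto
    have "(V * U) $$ (m, j) = (\<Sum>k<n. x m ^ k * coeff (p j) k)"
      using mj by (simp add: V_def U_def scalar_prod_def lessThan_atLeast0)
    also have "\<dots> = (\<Sum>k\<le>degree (p j). coeff (p j) k * x m ^ k)"
      using mj deg[of j]
      by (intro sum.mono_neutral_cong_right) (auto intro: coeff_eq_0)
    finally show "(V * U) $$ (m, j) = mat n n (\<lambda>(m, j). poly (p j) (x m)) $$ (m, j)"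
      using mj by (simp add: poly_altdef)
  qed (simp_all add: V_def U_def)
  have "C * (V * U) = mat n n (\<lambda>(i, j). \<Sum>m\<le>i. c i m * poly (p j) (x m))"
  proof (rule eq_matI, goal_cases)
    case (1 i j)
    then have ij: "i < n" "j < n" by auto
    then have "(C * (V * U)) $$ (i, j)
        = (\<Sum>m<n. (if m \<le> i then c i m else 0) * poly (p j) (x m))"
      by (simp add: VU C_def scalar_prod_def lessThan_atLeast0)
    also have "\<dots> = (\<Sum>m\<le>i. c i m * poly (p j) (x m))"
      using ij by (intro sum.mono_neutral_cong_right) auto
    finally show ?case using ij by simp
  qed (simp_all add: C_def VU)
  moreover have "det (C * (V * U)) = det C * (det V * det U)"
    using carr by (simp add: det_mult[of _ n])
  moreover have "det C = (\<Prod>i<n. c i i)"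
    using carr by (subst det_lower_triangular[of n])
      (auto simp: C_def prod_list_diag_prod lessThan_atLeast0)
  moreover have "det U = (\<Prod>j<n. coeff (p j) j)"
    using carr deg by (subst det_upper_triangular[of _ n])
      (auto simp: U_def prod_list_diag_prod lessThan_atLeast0 intro!: coeff_eq_0 le_less_trans[OF deg])
  ultimately show ?thesis by (simp add: V_def mult_ac)
qed

section \<open>Coefficients of reciprocal powers\<close>

text \<open>Apply the Leibniz rule to \<open>c ^ r * F = 1\<close> and cancel the nonzero factor
  \<open>c ^ r\<close>. Leaving \<open>D\<close> abstract lets both series share the
  argument.\<close>

lemma derivation_fps_recip1_power:
  fixes c u :: "'a::idom fps"
  assumes c0: "fps_nth c 0 = 1"
    and mult: "\<And>f g. D (f * g) = D f * g + f * D g"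
    and eigen: "D c = u * c"
  shows "D (fps_recip1 (c ^ r)) = - of_nat r * u * fps_recip1 (c ^ r)"
proof -
  define F where "F = fps_recip1 (c ^ r)"
  have "fps_nth (c ^ r) 0 = 1" using c0 by (simp add: fps_nth_power_0)
  then have inv: "c ^ r * F = 1" by (simp add: fps_recip1_unique F_def)
  have D1: "D 1 = 0" using mult[of 1 1] unfolding mult_1 mult_1_right by (metis add_cancel_right_right)
  have pow: "D (c ^ r) = of_nat r * u * c ^ r"
    by (induction r) (simp_all add: D1 mult eigen algebra_simps)
  have "0 = D (c ^ r) * F + c ^ r * D F"
    using inv D1 mult by metis
  also have "\<dots> = c ^ r * (of_nat r * u * F + D F)" by (simp add: pow algebra_simps)
  finally have "of_nat r * u * F + D F = 0" using inv by (metis mult_eq_0_iff zero_neq_one)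
  then show ?thesis by (simp add: F_def eq_neg_iff_add_eq_0 add.commute)
qed

lemma egf_coeff_Suc: "egf_coeff f (Suc k) = egf_coeff (fps_deriv f) k"
  by (simp add: egf_coeff_def algebra_simps)

lemma egf_coeff_recip1_0:
  assumes "fps_nth c 0 = 1"
  shows "egf_coeff (fps_recip1 (c ^ r)) 0 = 1"
  by (simp add: egf_coeff_def fps_recip1_def fps_right_inverse_constructor.simps)

text \<open>Comparing coefficients in \<open>(1 - x) F' = r F\<close> multiplies the
  \<open>k\<close>-th coefficient by \<open>r + k\<close> at each step.\<close>

lemma egf_coeff_recip1_one_minus_X:
  "egf_coeff (fps_recip1 ((1 - fps_X) ^ r) :: 'a::idom fps) k = pochhammer (of_nat r) k"
proof (induction k)
  case 0
  show ?case by (simp add: egf_coeff_recip1_0)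
next
  case (Suc k)
  define F where "F = (fps_recip1 ((1 - fps_X) ^ r) :: 'a fps)"
  have "(1 - fps_X) * fps_deriv F = - of_nat r * (- 1) * F"
    unfolding F_def
    by (rule derivation_fps_recip1_power) (simp_all add: algebra_simps)
  then have "fps_deriv F = of_nat r * F + fps_X * fps_deriv F"
    by (simp add: algebra_simps)
  then have "fps_nth (fps_deriv F) k = fps_nth (of_nat r * F + fps_X * fps_deriv F) k"
    by simp
  also have "\<dots> = of_nat r * fps_nth F k + of_nat k * fps_nth F k"
    by (cases k) (simp_all add: fps_of_nat[symmetric])
  finally have "egf_coeff F (Suc k) = (of_nat r + of_nat k) * egf_coeff F k"
    by (simp add: egf_coeff_Suc) (simp add: egf_coeff_def algebra_simps)
  then show ?case using Suc by (simp add: F_def pochhammer_Suc mult_ac)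
qed

definition fps_pderiv :: "'a::field_char_0 poly fps \<Rightarrow> 'a poly fps" where
  "fps_pderiv f = Abs_fps (\<lambda>k. pderiv (fps_nth f k))"

lemmas pderiv_sum = higher_pderiv_sum[of 1, simplified]

lemma fps_pderiv_mult: "fps_pderiv (f * g) = fps_pderiv f * g + f * fps_pderiv g"
  by (rule fps_ext)
    (simp add: fps_pderiv_def fps_mult_nth pderiv_sum pderiv_mult sum.distrib
      mult.commute[of "pderiv _"] add.commute)

text \<open>This is \<open>L\<^sub>r\<close> above, with \<open>[:1, 0, 1:]\<close> for
  \<open>s\<close> and \<open>[:0, 1:]\<close> for \<open>t\<close>.\<close>

definition sec_op :: "nat \<Rightarrow> 'a::field_char_0 poly \<Rightarrow> 'a poly" where
  "sec_op r p = [:1, 0, 1:] * pderiv p + of_nat r * [:0, 1:] * p"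

lemma sec_op_of_int_mult: "sec_op r (of_int k * p) = of_int k * sec_op r p"
proof -
  have "pderiv (of_int k :: 'a poly) = 0" by (simp add: of_int_poly)
  then show ?thesis
    by (simp only: sec_op_def pderiv_mult distrib_left mult_zero_left mult_zero_right
        add_0_left add_0_right mult_ac)
qed

text \<open>The left side is \<open>- sin x - t cos x + (1 + t^2) sin x\<close>, where the two bare
  sines cancel.\<close>

lemma cos_minus_t_sin_pde:
  "fps_deriv cos_minus_t_sin - fps_const [:1, 0, 1:] * fps_pderiv cos_minus_t_sin =
    - fps_const [:0, 1:] * (cos_minus_t_sin :: 'a::field_char_0 poly fps)"
proof -
  let ?C = "fps_constant_poly (fps_cos 1) :: 'a poly fps"
  let ?S = "fps_constant_poly (fps_sin 1) :: 'a poly fps"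
  have const: "fps_deriv (fps_constant_poly f) = fps_constant_poly (fps_deriv f)" for f :: "'a fps"
    by (rule fps_ext) (simp add: fps_constant_poly_def of_nat_poly)
  have neg: "fps_constant_poly (- f) = - fps_constant_poly f" for f :: "'a fps"
    by (rule fps_ext) (simp add: fps_constant_poly_def)
  have dx: "fps_deriv cos_minus_t_sin = - ?S - fps_const [:0, 1:] * ?C"
    by (simp add: cos_minus_t_sin_def const fps_sin_deriv fps_cos_deriv neg
      flip: fps_const_neg)
  have dt: "fps_pderiv cos_minus_t_sin = - ?S"
    by (rule fps_ext)
      (simp add: cos_minus_t_sin_def fps_pderiv_def fps_constant_poly_def pderiv_diff pderiv_mult
        pderiv_pCons)
  have s: "fps_const [:1, 0, 1 :: 'a:] = 1 + fps_const [:0, 1:] * fps_const [:0, 1:]"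
    by (simp add: fps_const_1_eq_1[symmetric] one_pCons del: fps_const_1_eq_1)
  show ?thesis unfolding dx dt s
    by (simp add: cos_minus_t_sin_def algebra_simps del: fps_const_neg fps_const_mult)
qed

text \<open>With eigenvalue \<open>- t\<close>, the derivation lemma says that differentiating
  \<open>F\<close> in \<open>x\<close> amounts to applying \<open>sec_op r\<close> to each
  coefficient.\<close>

lemma egf_coeff_recip1_cos_minus_t_sin:
  "egf_coeff (fps_recip1 (cos_minus_t_sin ^ r) :: 'a::field_char_0 poly fps) k = (sec_op r ^^ k) 1"
proof (induction k)
  case 0
  show ?case by (simp add: egf_coeff_recip1_0 fps_nth_cos_minus_t_sin_0)
next
  case (Suc k)
  define F where "F = (fps_recip1 (cos_minus_t_sin ^ r) :: 'a poly fps)"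
  have "fps_deriv F - fps_const [:1, 0, 1:] * fps_pderiv F = - of_nat r * (- fps_const [:0, 1:]) * F"
    unfolding F_def
    by (rule derivation_fps_recip1_power[where D = "\<lambda>f. fps_deriv f - fps_const [:1, 0, 1:] * fps_pderiv f"])
      (use cos_minus_t_sin_pde in \<open>simp_all add: fps_nth_cos_minus_t_sin_0 fps_pderiv_mult algebra_simps\<close>)
  then have "fps_deriv F = fps_const [:1, 0, 1:] * fps_pderiv F
      + fps_const (of_nat r) * (fps_const [:0, 1:] * F)"
    by (simp add: algebra_simps fps_of_nat del: fps_const_neg)
  then have "fps_nth (fps_deriv F) k = sec_op r (fps_nth F k)"
    by (simp only: fps_add_nth fps_mult_left_const_nth) (simp add: sec_op_def fps_pderiv_def)
  then have "egf_coeff F (Suc k) = sec_op r (egf_coeff F k)"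
    unfolding egf_coeff_Suc using sec_op_of_int_mult[of r "int (fact k)" "fps_nth F k"]
    by (simp add: egf_coeff_def)
  then show ?case using Suc by (simp add: F_def)
qed

section \<open>Iterates of the derivative operator\<close>

lemma sec_op_sum: "(sec_op r ^^ j) (\<Sum>m\<in>A. of_int (c m) * f m) =
    (\<Sum>m\<in>A. of_int (c m) * (sec_op r ^^ j) (f m :: 'a::field_char_0 poly))"
proof -
  have add: "sec_op r (p + q) = sec_op r p + sec_op r q" for p q :: "'a poly"
    by (simp only: sec_op_def pderiv_add distrib_left add_ac)
  have zero: "sec_op r (0 :: 'a poly) = 0" by (simp add: sec_op_def)
  have "sec_op r (\<Sum>m\<in>A. of_int (c m) * f m) = (\<Sum>m\<in>A. of_int (c m) * sec_op r (f m))"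
    for f :: "_ \<Rightarrow> 'a poly"
    by (induction A rule: infinite_finite_induct)
      (simp_all add: add sec_op_of_int_mult zero)
  then show ?thesis by (induction j) simp_all
qed

lemma pderiv_power_one_plus_square:
  "[:1, 0, 1:] * pderiv ([:1, 0, 1 :: 'a::field_char_0:] ^ m)
    = of_nat (2 * m) * [:0, 1:] * [:1, 0, 1:] ^ m"
proof -
  define s t where "s = [:1, 0, 1 :: 'a:]" and "t = [:0, 1 :: 'a:]"
  have "pderiv s = 2 * t" by (simp add: s_def t_def pderiv_pCons numeral_poly)
  then have "s * pderiv (s ^ m) = of_nat (2 * m) * t * s ^ m"
    by (induction m) (simp_all add: pderiv_mult algebra_simps)
  then show ?thesis by (simp only: s_def t_def)
qed

text \<open>Since \<open>s (s^m)' = 2 m t s^m\<close>, moving \<open>s^m\<close> out of the operator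
  only shifts its parameter by \<open>2 m\<close>.\<close>

lemma sec_op_power_mult:
  "sec_op r ([:1, 0, 1:] ^ m * p) = [:1, 0, 1:] ^ m * sec_op (r + 2 * m) (p :: 'a::field_char_0 poly)"
proof -
  define s t where "s = [:1, 0, 1 :: 'a:]" and "t = [:0, 1 :: 'a:]"
  have "s * pderiv (s ^ m) * p = of_nat (2 * m) * t * s ^ m * p"
    by (simp only: s_def t_def pderiv_power_one_plus_square)
  then have "s * pderiv (s ^ m * p) + of_nat r * t * (s ^ m * p)
      = s ^ m * (s * pderiv p + of_nat (r + 2 * m) * t * p)"
    by (simp add: pderiv_mult algebra_simps)
  then show ?thesis by (simp only: sec_op_def s_def t_def)
qed

lemma sec_op_funpow_power:
  "(sec_op r ^^ j) ([:1, 0, 1:] ^ m) = [:1, 0, 1:] ^ m * (sec_op (r + 2 * m) ^^ j) 1"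
proof -
  have "(sec_op r ^^ j) ([:1, 0, 1:] ^ m * p) = [:1, 0, 1:] ^ m * (sec_op (r + 2 * m) ^^ j) p" for p
    by (induction j) (simp_all add: sec_op_power_mult)
  from this[of 1] show ?thesis by simp
qed

text \<open>These will be the coefficients of \<open>(sec_op r ^^ (2 * i)) 1\<close> in powers of
  \<open>s\<close>. They are integers, so every \<open>sec_op\<close> commutes with them.\<close>

fun sec_coeff :: "nat \<Rightarrow> nat \<Rightarrow> nat \<Rightarrow> int" where
  "sec_coeff r 0 m = (if m = 0 then 1 else 0)"
| "sec_coeff r (Suc i) 0 = - (int r)\<^sup>2 * sec_coeff r i 0"
| "sec_coeff r (Suc i) (Suc m) =
    (int r + 2 * int m) * (int r + 2 * int m + 1) * sec_coeff r i m
      - (int r + 2 * int (Suc m))\<^sup>2 * sec_coeff r i (Suc m)"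

lemma sec_coeff_eq_0: "i < m \<Longrightarrow> sec_coeff r i m = 0"
  by (induction r i m rule: sec_coeff.induct) auto

text \<open>On the diagonal the second term of the recurrence vanishes, and the first adds the next
  two factors of the rising factorial.\<close>

lemma sec_coeff_diag: "sec_coeff r i i = pochhammer (int r) (2 * i)"
  by (induction i) (simp_all add: sec_coeff_eq_0 pochhammer_Suc algebra_simps)

text \<open>Pulling out \<open>s^m\<close> leaves \<open>q (s + q t^2)\<close> with
  \<open>q = r + 2 m\<close>; then \<open>t^2 = s - 1\<close>.\<close>

lemma sec_op_twice_power:
  "sec_op r (sec_op r ([:1, 0, 1:] ^ m)) =
    of_int ((int r + 2 * int m) * (int r + 2 * int m + 1)) * [:1, 0, 1:] ^ Suc m
      - of_int ((int r + 2 * int m)\<^sup>2) * [:1, 0, 1 :: 'a::field_char_0:] ^ m"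
proof -
  define q where "q = r + 2 * m"
  define s t where "s = [:1, 0, 1 :: 'a:]" and "t = [:0, 1 :: 'a:]"
  have op: "sec_op k p = s * pderiv p + of_nat k * t * p" for k p
    by (simp only: sec_op_def s_def t_def)
  have t1: "pderiv t = 1" by (simp add: t_def pderiv_pCons)
  have s_t: "s = 1 + t * t" by (simp add: s_def t_def one_pCons)
  have "sec_op q (sec_op q 1) = of_nat q * (s + of_nat q * t * t)"
    by (simp add: op pderiv_mult t1 algebra_simps)
  also have "\<dots> = of_nat q * (of_nat q + 1) * s - (of_nat q)\<^sup>2"
    unfolding s_t by (simp add: algebra_simps power2_eq_square)
  also have "\<dots> = of_int ((int r + 2 * int m) * (int r + 2 * int m + 1)) * s
      - of_int ((int r + 2 * int m)\<^sup>2)"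
    by (simp add: q_def)
  finally have "s ^ m * sec_op q (sec_op q 1) = of_int ((int r + 2 * int m) * (int r + 2 * int m + 1)) * s ^ Suc m
      - of_int ((int r + 2 * int m)\<^sup>2) * s ^ m"
    by (simp only: right_diff_distrib power_Suc mult_ac)
  moreover have "sec_op r (sec_op r (s ^ m * 1)) = s ^ m * sec_op q (sec_op q 1)"
    by (simp only: s_def sec_op_power_mult q_def)
  ultimately show ?thesis by (simp only: s_def mult_1_right)
qed

lemma sec_op_funpow_even:
  "(sec_op r ^^ (2 * i)) 1 = (\<Sum>m\<le>i. of_int (sec_coeff r i m) * [:1, 0, 1:] ^ m)"
proof (induction i)
  case 0
  show ?case by simp
next
  case (Suc i)
  let ?s = "[:1, 0, 1 :: 'a:]" and ?q = "\<lambda>m. int r + 2 * int m"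
  have "(sec_op r ^^ (2 * Suc i)) 1 = (sec_op r ^^ 2) ((sec_op r ^^ (2 * i)) 1)"
    by (simp add: numeral_2_eq_2)
  also have "\<dots> = (\<Sum>m\<le>i. of_int (sec_coeff r i m) * (sec_op r ^^ 2) (?s ^ m))"
    by (simp only: Suc sec_op_sum)
  also have "\<dots> = (\<Sum>m\<le>i. of_int (?q m * (?q m + 1) * sec_coeff r i m) * ?s ^ Suc m)
      - (\<Sum>m\<le>i. of_int ((?q m)\<^sup>2 * sec_coeff r i m) * ?s ^ m)"
    unfolding numeral_2_eq_2 funpow.simps o_apply id_apply sec_op_twice_power
      sum_subtractf[symmetric]
    by (rule sum.cong) (simp_all only: of_int_mult of_int_power right_diff_distrib mult_ac numeral_2_eq_2)
  \<comment> \<open>The added term is zero. The longer range allows \<open>m = 0\<close> to be split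
    off, so that the rest aligns with the sum over \<open>?s ^ Suc m\<close>.\<close>
  also have "(\<Sum>m\<le>i. of_int ((?q m)\<^sup>2 * sec_coeff r i m) * ?s ^ m)
      = (\<Sum>m\<le>Suc i. of_int ((?q m)\<^sup>2 * sec_coeff r i m) * ?s ^ m)"
    by (simp add: sec_coeff_eq_0)
  finally show ?case
    unfolding sum.atMost_Suc_shift sec_coeff.simps sum_subtractf of_int_diff left_diff_distrib
    by simp
qed

text \<open>The iterates on 1 with the parameter made generic: the outer indeterminate stands for
  \<open>q\<close>, the inner one for \<open>t\<close>.\<close>

fun sec_poly :: "nat \<Rightarrow> 'a::field_char_0 poly poly" where
  "sec_poly 0 = 1"
| "sec_poly (Suc j) = map_poly (\<lambda>p. [:1, 0, 1:] * pderiv p) (sec_poly j) + [:0, [:0, 1:]:] * sec_poly j"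

lemma coeff_sec_poly_Suc:
  "coeff (sec_poly (Suc j)) k = [:1, 0, 1:] * pderiv (coeff (sec_poly j) k)
    + (case k of 0 \<Rightarrow> 0 | Suc l \<Rightarrow> [:0, 1:] * coeff (sec_poly j) l)"
  by (simp add: coeff_map_poly coeff_pCons split: nat.split)

lemma sec_poly_eq_0: "j < k \<Longrightarrow> coeff (sec_poly j) k = 0"
proof (induction j arbitrary: k)
  case (Suc j)
  then show ?case by (cases k) (simp_all only: coeff_sec_poly_Suc, simp_all)
qed auto

lemma degree_sec_poly: "degree (sec_poly j) \<le> j"
  by (simp add: degree_le sec_poly_eq_0)

lemma coeff_sec_poly_diag: "coeff (sec_poly j) j = [:0, 1:] ^ j"
proof (induction j)
  case (Suc j)
  then show ?case by (simp only: coeff_sec_poly_Suc) (simp add: sec_poly_eq_0)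
qed simp

text \<open>The point \<open>of_nat q\<close> is constant in \<open>t\<close>, so evaluation there
  commutes with \<open>s d/dt\<close>.\<close>

lemma poly_sec_poly: "poly (sec_poly j) (of_nat q) = (sec_op q ^^ j) (1 :: 'a::field_char_0 poly)"
proof (induction j)
  case (Suc j)
  have "poly (map_poly (\<lambda>p. [:1, 0, 1:] * pderiv p) P) (of_nat q)
      = [:1, 0, 1:] * pderiv (poly P (of_nat q))" for P :: "'a poly poly"
    by (induction P) (simp_all add: map_poly_pCons pderiv_add pderiv_mult algebra_simps)
  then show ?case using Suc by (simp add: sec_op_def mult_ac)
qed simp

lemma degree_pochhammer_X: "degree (pochhammer [:0, 1 :: 'a::idom:] j) = j"
  and lead_coeff_pochhammer_X: "coeff (pochhammer [:0, 1 :: 'a::idom:] j) j = 1"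
proof -
  have "degree (pochhammer [:0, 1 :: 'a:] j) = j \<and> lead_coeff (pochhammer [:0, 1 :: 'a:] j) = 1"
  proof (induction j)
    case (Suc j)
    have "[:0, 1 :: 'a:] + of_nat j = [:of_nat j, 1:]" by (simp add: of_nat_poly)
    moreover have "pochhammer [:0, 1 :: 'a:] j \<noteq> 0" using Suc by auto
    ultimately show ?case
      using Suc lead_coeff_mult[of "pochhammer [:0, 1 :: 'a:] j" "[:of_nat j, 1:]"]
      by (auto simp add: pochhammer_Suc degree_mult_eq simp del: mult_pCons_right)
  qed simp
  then show "degree (pochhammer [:0, 1 :: 'a:] j) = j" "coeff (pochhammer [:0, 1 :: 'a:] j) j = 1"
    by auto
qed

theorem theorem16p1:
  fixes r n :: nat
  assumes "r \<ge> 1" and "n \<ge> 1"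
  shows "dilated_hankel n (fps_recip1 (cos_minus_t_sin ^ r) :: 'a::field_char_0 poly fps) =
           ([:0, 1:] * ([:0, 1:] ^ 2 + 1)) ^ (n choose 2) *
             dilated_hankel n (fps_recip1 ((1 - fps_X) ^ r))"
proof -
  let ?t = "[:0, 1 :: 'a:]" and ?s = "[:1, 0, 1 :: 'a:]"
  define x where "x = (\<lambda>m. of_nat (r + 2 * m) :: 'a poly)"
  define V where "V = det (mat n n (\<lambda>(i, j). x i ^ j))"
  \<comment> \<open>\<open>R\<close> is the row factor common to both sides; only the powers of
    \<open>s\<close> and \<open>t\<close> distinguish them.\<close>
  define R where "R = (\<Prod>i<n. pochhammer (of_nat r :: 'a poly) (2 * i))"
  have s: "?t ^ 2 + 1 = ?s" by (simp add: power2_eq_square one_pCons)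
  have tri: "(\<Prod>i<n. a ^ i) = a ^ (n choose 2)" for a :: "'a poly"
    by (induction n) (simp_all add: numeral_2_eq_2 power_add mult.commute)
  have "(sec_op r ^^ (2 * i + j)) 1
      = (\<Sum>m\<le>i. of_int (sec_coeff r i m) * ?s ^ m * poly (sec_poly j) (x m))" for i j
  proof -
    have "(sec_op r ^^ (2 * i + j)) (1 :: 'a poly) = (sec_op r ^^ j) ((sec_op r ^^ (2 * i)) 1)"
      by (simp add: funpow_add add.commute)
    then show ?thesis
      by (simp only: sec_op_funpow_even sec_op_sum sec_op_funpow_power poly_sec_poly x_def mult.assoc)
  qed
  then have "dilated_hankel n (fps_recip1 (cos_minus_t_sin ^ r)) =
      (\<Prod>i<n. of_int (sec_coeff r i i) * ?s ^ i) * (\<Prod>j<n. ?t ^ j) * V"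
    unfolding dilated_hankel_def egf_coeff_recip1_cos_minus_t_sin V_def
    by (simp only: det_triangular_poly_triangular degree_sec_poly coeff_sec_poly_diag)
  also have "(\<Prod>i<n. of_int (sec_coeff r i i) * ?s ^ i) = R * ?s ^ (n choose 2)"
    unfolding prod.distrib tri R_def
    by (simp add: sec_coeff_diag pochhammer_of_int[symmetric])
  finally have left: "dilated_hankel n (fps_recip1 (cos_minus_t_sin ^ r)) =
      R * ?s ^ (n choose 2) * ?t ^ (n choose 2) * V"
    by (simp only: tri)
  \<comment> \<open>Here the row combination is diagonal: the rising factorial splits after
    \<open>2 i\<close> factors, and the remaining \<open>j\<close> start at
    \<open>r + 2 i = x i\<close>.\<close>
  have "pochhammer (of_nat r) (2 * i + j) =
      (\<Sum>m\<le>i. (if m = i then pochhammer (of_nat r) (2 * i) else 0) * poly (pochhammer [:0, 1:] j) (x m))"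
    for i j
  proof -
    have "poly (pochhammer [:0, 1:] j) (x i) = pochhammer (x i) j"
      by (induction j) (simp_all add: pochhammer_Suc)
    then show ?thesis
      by (simp add: if_distrib[of "\<lambda>y. y * _"] pochhammer_product' x_def cong: if_cong)
  qed
  then have "dilated_hankel n (fps_recip1 ((1 - fps_X) ^ r)) = R * V"
    unfolding dilated_hankel_def egf_coeff_recip1_one_minus_X V_def R_def
    by (simp add: det_triangular_poly_triangular degree_pochhammer_X
        lead_coeff_pochhammer_X)
  then show ?thesis unfolding left s by (simp only: power_mult_distrib mult_ac)
qed

end
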